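(* Let $n\ge 1$ be an integer. Let $A_n$ be the set of partitions $a_1\ge a_2\ge\dots\ge a_n\ge 1$ with exactly $n$ parts, all of them congruent to $2$ or $3$ modulo $5$, and let $B_n$ be the set of partitions $(b_1,\dots,b_n)$ with exactly $n$ parts satisfying $b_s-b_{s+1}\ge 2$ for $1\le s\le n-1$ and $b_n\ge 2$. Put $$\pi_1(s):=\begin{cases} n^2+1,& s=1,\\ 1,& s=2,\dots,n,\end{cases}\qquad \pi_c(s):=2(n+1-s),\quad s=1,\dots,n.$$ Then the map $(a_1,\dots,a_n)\mapsto (b_1,\dots,b_n)$ given by $$b_s=a_s-3q_s-1+n^2\delta(1,s)-\pi_1(s)+\pi_c(s),\qquad q_s:=\left\lfloor \frac{a_s}{5}\right\rfloor,\qquad s=1,\dots,n,$$ is a bijection from $A_n$ onto $B_n$. Its inverse is given by $$a_s=b_s+3k_s+1-n^2\delta(1,s)-\pi_c(s)+\pi_1(s),\qquad k_s:=\left\lfloor\frac{b_s-1-n^2\delta(1,s)-\pi_c(s)+\pi_1(s)}{2}\right\rfloor,\qquad s=1,\dots,n,$$ and $k_s=q_s$ for corresponding partitions. Moreover, if $N_a=\sum_{s=1}^n a_s$ and $N_b=\sum_{s=1}^n b_s$ are the weights of corresponding partitions, then $$N_b=N_a+n^2-\sum_{s=1}^n(3q_s+1).$$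
   Context: $\delta$ is the Kronecker delta: $\delta(1,s)=1$ if $s=1$ and $0$ otherwise. The weight of a partition is the sum of its parts. *)

theory Defs
  imports Main "HOL-Library.FuncSet" "HOL-Number_Theory.Cong"
begin

(* A partition with exactly n parts is the tuple of its parts in weakly decreasing order,
   indexed by 1..n and undefined outside that range, so that equality of functions is
   equality of partitions. Parts are integers because the formulas below subtract. *)
definition partitions :: "nat \<Rightarrow> (nat \<Rightarrow> int) set" where
  "partitions n = {a \<in> {1..n} \<rightarrow>\<^sub>E {1..}. \<forall>s\<in>{1..<n}. a s \<ge> a (s + 1)}"

definition weight :: "nat \<Rightarrow> (nat \<Rightarrow> int) \<Rightarrow> int" where
  "weight n a = (\<Sum>s=1..n. a s)"

definition partitions_A :: "nat \<Rightarrow> (nat \<Rightarrow> int) set" where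
  "partitions_A n =
    {a \<in> partitions n. \<forall>s\<in>{1..n}. [a s = 2] (mod 5) \<or> [a s = 3] (mod 5)}"

definition partitions_B :: "nat \<Rightarrow> (nat \<Rightarrow> int) set" where
  "partitions_B n =
    {b \<in> partitions n. (\<forall>s\<in>{1..<n}. b s - b (s + 1) \<ge> 2) \<and> b n \<ge> 2}"

definition kronecker_delta :: "nat \<Rightarrow> nat \<Rightarrow> int" where
  "kronecker_delta i j = (if i = j then 1 else 0)"

definition pi_1 :: "nat \<Rightarrow> nat \<Rightarrow> int" where
  "pi_1 n s = (if s = 1 then (int n)\<^sup>2 + 1 else 1)"

definition pi_c :: "nat \<Rightarrow> nat \<Rightarrow> int" where
  "pi_c n s = 2 * (int n + 1 - int s)"

(* On int, div rounds towards minus infinity, i.e. it is the floor of the quotient. *)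
definition quot_q :: "(nat \<Rightarrow> int) \<Rightarrow> nat \<Rightarrow> int" where
  "quot_q a s = a s div 5"

definition quot_k :: "nat \<Rightarrow> (nat \<Rightarrow> int) \<Rightarrow> nat \<Rightarrow> int" where
  "quot_k n b s =
    (b s - 1 - (int n)\<^sup>2 * kronecker_delta 1 s - pi_c n s + pi_1 n s) div 2"

definition forward_map :: "nat \<Rightarrow> (nat \<Rightarrow> int) \<Rightarrow> (nat \<Rightarrow> int)" where
  "forward_map n a = (\<lambda>s\<in>{1..n}.
     a s - 3 * quot_q a s - 1 + (int n)\<^sup>2 * kronecker_delta 1 s - pi_1 n s + pi_c n s)"

definition backward_map :: "nat \<Rightarrow> (nat \<Rightarrow> int) \<Rightarrow> (nat \<Rightarrow> int)" where
  "backward_map n b = (\<lambda>s\<in>{1..n}.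
     b s + 3 * quot_k n b s + 1 - (int n)\<^sup>2 * kronecker_delta 1 s - pi_c n s + pi_1 n s)"

end

(* Write a part congruent to 2 or 3 modulo 5 as a = 5 q + 2 + e with e in {0, 1}. The terms in n^2 and
   pi_1 cancel, and the map becomes a |-> 2 q + e, shifted by pi_c(s). On single parts a |-> 2 q + e is
   an increasing bijection from these residue classes onto the integers, with q = (2 q + e) div 2.
   Since pi_c drops by 2 at each step and ends with pi_c(n) = 2, the shift turns "weakly
   decreasing and nonnegative" into "differences at least 2 and last part at least 2". *)
theory Submission
  imports Defs
begin

text \<open>The forward map on one part before the shift by \<open>pi_c\<close>. The constant 2
  joins the 1 of the formula to the 1 left of \<open>pi_1\<close> once its n^2 term has cancelled
  against the Kronecker delta.\<close>

definition contract :: "int \<Rightarrow> int" where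
  "contract x = x - 3 * (x div 5) - 2"

definition expand :: "int \<Rightarrow> int" where
  "expand y = y + 3 * (y div 2) + 2"

lemma mod_5_cases:
  fixes x :: int
  assumes "[x = 2] (mod 5) \<or> [x = 3] (mod 5)"
  obtains q e where "x = 5 * q + 2 + e" "e = 0 \<or> e = 1"
proof
  show "x = 5 * (x div 5) + 2 + (x mod 5 - 2)"
    by simp
  show "x mod 5 - 2 = 0 \<or> x mod 5 - 2 = 1"
    using assms by (auto simp: cong_def)
qed

lemma contract_eq: "e = 0 \<or> e = 1 \<Longrightarrow> contract (5 * q + 2 + e) = 2 * q + e"
  by (auto simp: contract_def)

lemma expand_eq: "e = 0 \<or> e = 1 \<Longrightarrow> expand (2 * q + e) = 5 * q + 2 + e"
  by (auto simp: expand_def)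

lemma expand_contract:
  assumes "[x = 2] (mod 5) \<or> [x = 3] (mod 5)"
  shows "expand (contract x) = x"
proof -
  obtain q e where "x = 5 * q + 2 + e" "e = 0 \<or> e = 1"
    using assms by (rule mod_5_cases)
  then show ?thesis
    by (simp only: contract_eq expand_eq)
qed

lemma contract_div_2:
  assumes "[x = 2] (mod 5) \<or> [x = 3] (mod 5)"
  shows "contract x div 2 = x div 5"
proof -
  obtain q e where "x = 5 * q + 2 + e" "e = 0 \<or> e = 1"
    using assms by (rule mod_5_cases)
  then show ?thesis
    by (auto simp: contract_def)
qed

lemma even_odd_cases:
  fixes y :: int
  obtains q e where "y = 2 * q + e" "e = 0 \<or> e = 1"
proof
  show "y = 2 * (y div 2) + y mod 2"
    by simp
  show "y mod 2 = 0 \<or> y mod 2 = 1"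
    by presburger
qed

lemma contract_expand: "contract (expand y) = y"
proof -
  obtain q e where "y = 2 * q + e" "e = 0 \<or> e = 1"
    by (rule even_odd_cases)
  then show ?thesis
    by (simp only: expand_eq contract_eq)
qed

lemma expand_cong: "[expand y = 2] (mod 5) \<or> [expand y = 3] (mod 5)"
proof -
  obtain q e where "y = 2 * q + e" and e: "e = 0 \<or> e = 1"
    by (rule even_odd_cases)
  then have "expand y = 5 * q + 2 + e"
    by (simp only: expand_eq)
  also have "\<dots> mod 5 = (2 + e) mod 5"
    by (simp add: add.assoc)
  finally show ?thesis
    using e by (auto simp: cong_def)
qed

text \<open>If q < q', then 2 q + e \<le> 2 q + 1 < 2 q' + e'; if q = q', then e \<le> e'. The
  residues matter: \<open>contract\<close> sends 4 to 2 but 5 to 0.\<close>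

lemma contract_mono:
  assumes "[x = 2] (mod 5) \<or> [x = 3] (mod 5)" "[y = 2] (mod 5) \<or> [y = 3] (mod 5)" "x \<le> y"
  shows "contract x \<le> contract y"
proof -
  obtain q e where "x = 5 * q + 2 + e" "e = 0 \<or> e = 1"
    using assms(1) by (rule mod_5_cases)
  moreover obtain q' e' where "y = 5 * q' + 2 + e'" "e' = 0 \<or> e' = 1"
    using assms(2) by (rule mod_5_cases)
  ultimately show ?thesis
    using \<open>x \<le> y\<close> by (auto simp: contract_eq)
qed

text \<open>A negative q would give x \<le> -5 + 2 + 1 < 1, so q and hence 2 q + e are
  nonnegative.\<close>

lemma contract_nonneg:
  assumes "[x = 2] (mod 5) \<or> [x = 3] (mod 5)" "1 \<le> x"
  shows "0 \<le> contract x"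
proof -
  obtain q e where "x = 5 * q + 2 + e" "e = 0 \<or> e = 1"
    using assms(1) by (rule mod_5_cases)
  then show ?thesis
    using \<open>1 \<le> x\<close> by (auto simp: contract_eq)
qed

lemma expand_mono: "x \<le> y \<Longrightarrow> expand x \<le> expand y"
  unfolding expand_def by (simp add: add_mono zdiv_mono1)

lemma pi_1_eq: "pi_1 n s = (int n)\<^sup>2 * kronecker_delta 1 s + 1"
  by (simp add: pi_1_def kronecker_delta_def)

lemma pi_c_Suc: "pi_c n (Suc s) = pi_c n s - 2"
  by (simp add: pi_c_def)

lemma forward_map_eq: "forward_map n a = (\<lambda>s\<in>{1..n}. contract (a s) + pi_c n s)"
  by (auto simp: forward_map_def pi_1_eq quot_q_def contract_def restrict_def)

lemma quot_k_eq: "quot_k n b s = (b s - pi_c n s) div 2"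
  by (simp add: quot_k_def pi_1_eq)

lemma backward_map_eq: "backward_map n b = (\<lambda>s\<in>{1..n}. expand (b s - pi_c n s))"
  by (auto simp: backward_map_def pi_1_eq quot_k_eq expand_def restrict_def)

lemma sum_pi_c: "(\<Sum>s=1..n. pi_c n s) = (int n)\<^sup>2 + int n"
proof (induction n)
  case (Suc n)
  \<comment> \<open>Passing from n to n + 1 raises each old term by 2 and appends a last term
    2.\<close>
  have "(\<Sum>s=1..n. pi_c (Suc n) s) = (\<Sum>s=1..n. pi_c n s + 2)"
    by (rule sum.cong) (auto simp: pi_c_def)
  also have "\<dots> = (\<Sum>s=1..n. pi_c n s) + 2 * int n"
    by (simp add: sum.distrib)
  finally show ?case
    using Suc by (simp add: pi_c_def power2_eq_square algebra_simps)
qed simp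

lemma forward_map_in_B:
  assumes "n \<ge> 1" "a \<in> partitions_A n"
  shows "forward_map n a \<in> partitions_B n"
proof -
  have res: "[a s = 2] (mod 5) \<or> [a s = 3] (mod 5)" and "a s \<ge> 1" if "s \<in> {1..n}" for s
    using assms(2) that by (auto simp: partitions_A_def partitions_def)
  then have nonneg: "0 \<le> contract (a s)" if "s \<in> {1..n}" for s
    using contract_nonneg that by blast
  \<comment> \<open>For s \<le> n the shift is at least 2. This bound gives both the positivity of
    all parts and, at s = n, the condition on the last part.\<close>
  have pos: "forward_map n a s \<ge> 2" if "s \<in> {1..n}" for s
    using nonneg[OF that] that by (simp add: forward_map_eq pi_c_def)
  have diff: "forward_map n a s - forward_map n a (s + 1) \<ge> 2" if "s \<in> {1..<n}" for s
  proof -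
    have "a (s + 1) \<le> a s"
      using assms(2) that by (auto simp: partitions_A_def partitions_def)
    then have "contract (a (s + 1)) \<le> contract (a s)"
      using res that by (intro contract_mono) auto
    then show ?thesis
      using that by (simp add: forward_map_eq pi_c_Suc)
  qed
  have "forward_map n a \<in> {1..n} \<rightarrow>\<^sub>E {1..}"
    using pos by (force simp: forward_map_eq)
  then show ?thesis
    using diff pos[of n] assms(1) by (force simp: partitions_B_def partitions_def)
qed

text \<open>Downward induction from s = n, where \<open>pi_c\<close> equals 2: each step to a
  smaller index raises the part by at least 2 and \<open>pi_c\<close> by exactly 2. So undoing the
  shift leaves nonnegative integers.\<close>

lemma partitions_B_ge_pi_c:
  assumes "b \<in> partitions_B n" "1 \<le> s" "s \<le> n"
  shows "pi_c n s \<le> b s"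
  using assms(3,2)
proof (induction s rule: inc_induct)
  case base
  then show ?case
    using assms(1) by (simp add: partitions_B_def pi_c_def)
next
  case (step s)
  then have "b s - b (Suc s) \<ge> 2"
    using assms(1) by (auto simp: partitions_B_def)
  then show ?case
    using step by (simp add: pi_c_Suc)
qed

lemma backward_map_in_A:
  assumes "b \<in> partitions_B n"
  shows "backward_map n b \<in> partitions_A n"
proof -
  \<comment> \<open>The argument is nonnegative, and \<open>expand\<close> is monotone with value 2
    at 0.\<close>
  have "expand (b s - pi_c n s) \<ge> 1" if "s \<in> {1..n}" for s
    using expand_mono[of 0 "b s - pi_c n s"] partitions_B_ge_pi_c[OF assms, of s] that
    by (simp add: expand_def)
  then have "backward_map n b \<in> {1..n} \<rightarrow>\<^sub>E {1..}"
    by (auto simp: backward_map_eq)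
  moreover have "backward_map n b (s + 1) \<le> backward_map n b s" if "s \<in> {1..<n}" for s
  proof -
    have "b s - b (Suc s) \<ge> 2"
      using assms that by (auto simp: partitions_B_def)
    then have "expand (b (Suc s) - pi_c n (Suc s)) \<le> expand (b s - pi_c n s)"
      by (intro expand_mono) (simp add: pi_c_Suc)
    then show ?thesis
      using that by (simp add: backward_map_eq)
  qed
  ultimately show ?thesis
    using expand_cong by (auto simp: partitions_A_def partitions_def backward_map_eq)
qed

lemma forward_backward_map:
  assumes "b \<in> partitions_B n"
  shows "forward_map n (backward_map n b) = b"
proof -
  \<comment> \<open>Both sides are undefined outside the index range, so only the indices from 1 to
    n have to be compared.\<close>
  have "b \<in> extensional {1..n}"
    using assms by (auto simp: partitions_B_def partitions_def PiE_def)
  then show ?thesis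
    by (intro extensionalityI[of _ "{1..n}"])
       (auto simp: forward_map_eq backward_map_eq contract_expand)
qed

lemma backward_forward_map:
  assumes "a \<in> partitions_A n"
  shows "backward_map n (forward_map n a) = a"
proof -
  have "a \<in> extensional {1..n}"
    using assms by (auto simp: partitions_A_def partitions_def PiE_def)
  then show ?thesis
    using assms by (intro extensionalityI[of _ "{1..n}"])
       (auto simp: forward_map_eq backward_map_eq partitions_A_def expand_contract)
qed

lemma quot_k_forward_map:
  assumes "a \<in> partitions_A n" "s \<in> {1..n}"
  shows "quot_k n (forward_map n a) s = quot_q a s"
proof -
  have "contract (a s) div 2 = a s div 5"
    using assms by (intro contract_div_2) (auto simp: partitions_A_def)
  then show ?thesis
    using assms(2) by (simp add: quot_k_eq forward_map_eq quot_q_def)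
qed

lemma weight_forward_map:
  "weight n (forward_map n a) = weight n a + (int n)\<^sup>2 - (\<Sum>s=1..n. 3 * quot_q a s + 1)"
proof -
  \<comment> \<open>The 2 in \<open>contract\<close> is split as 1 + 1: one unit joins 3 q, as in
    the claimed sum, and the other adds up to n, which cancels the n in the sum n^2 + n of the
    shifts.\<close>
  have "weight n (forward_map n a) = (\<Sum>s=1..n. a s - (3 * quot_q a s + 1) - 1 + pi_c n s)"
    unfolding weight_def
    by (rule sum.cong) (auto simp: forward_map_eq contract_def quot_q_def)
  also have "\<dots> = weight n a - (\<Sum>s=1..n. 3 * quot_q a s + 1) - int n + (\<Sum>s=1..n. pi_c n s)"
    by (simp only: weight_def sum.distrib sum_subtractf) simp
  finally show ?thesis
    unfolding sum_pi_c by simp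
qed

theorem mainTheorem4:
  fixes n :: nat
  assumes "n \<ge> 1"
  shows "bij_betw (forward_map n) (partitions_A n) (partitions_B n)
    \<and> (\<forall>b\<in>partitions_B n. backward_map n b \<in> partitions_A n
          \<and> forward_map n (backward_map n b) = b)
    \<and> (\<forall>a\<in>partitions_A n. backward_map n (forward_map n a) = a)
    \<and> (\<forall>a\<in>partitions_A n. \<forall>b\<in>partitions_B n. b = forward_map n a \<longrightarrow>
          (\<forall>s\<in>{1..n}. quot_k n b s = quot_q a s)
          \<and> weight n b = weight n a + (int n)\<^sup>2 - (\<Sum>s=1..n. 3 * quot_q a s + 1))"
proof -
  have "bij_betw (forward_map n) (partitions_A n) (partitions_B n)"
    by (rule bij_betw_byWitness[where f' = "backward_map n"])
       (auto simp: forward_map_in_B[OF assms] backward_map_in_A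
          forward_backward_map backward_forward_map)
  then show ?thesis
    by (simp add: backward_map_in_A forward_backward_map backward_forward_map
        quot_k_forward_map weight_forward_map)
qed

end
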